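(* Let $m\in\mathbb Z^+$, and let $P_0(x),\ldots,P_{m-1}(x)\in\mathbb C[x]$ have degrees $0,\ldots,m-1$ respectively. Let $m_1,\ldots,m_k\in\mathbb Z$ and $\mu_1,\ldots,\mu_k\in\mathbb C$. If $A=\{a_s(n_s)\}_{s=1}^k$ forms an $m$-cover of $\mathbb Z$, then $$\sum_{\substack{I\subseteq[1,k]\\ \{\sum_{s\in I}m_s/n_s\}=\theta}}(-1)^{|I|}P_n\Big(\sum_{s\in I}\mu_s\Big)e^{2\pi i\sum_{s\in I}a_sm_s/n_s}=0$$ for all $0\le\theta<1$ and $n\in[0,m-1]$. Conversely, suppose $m_1,\ldots,m_k$ are relatively prime to $n_1,\ldots,n_k$ respectively, and $\mu_1,\ldots,\mu_k$ are all nonzero. Then, if the displayed identity holds for all $0\le\theta<1$ and all $n\in[0,m-1]$, the system $A$ is an $m$-cover of $\mathbb Z$.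
   Context: Here $a(n)=a+n\mathbb Z$ denotes a residue class with modulus $n\in\mathbb Z^+$. A finite system $A=\{a_s(n_s)\}_{s=1}^k$ is an $m$-cover of $\mathbb Z$ if every integer lies in at least $m$ of the residue classes $a_s(n_s)$. $[1,k]=\{1,\ldots,k\}$, and $\{\alpha\}$ denotes the fractional part of a real number $\alpha$. *)

theory Defs
  imports Complex_Main "HOL-Computational_Algebra.Polynomial"
begin

definition residue_class :: "int \<Rightarrow> nat \<Rightarrow> int set" where
  "residue_class a n = {a + int n * q | q. True}"

text \<open>A finite system of residue classes is an indexed family \<open>a\<^sub>s(n\<^sub>s)\<close>, \<open>1 \<le> s \<le> k\<close>, so repeated
  classes are counted with multiplicity.\<close>

definition is_m_cover :: "nat \<Rightarrow> nat \<Rightarrow> (nat \<Rightarrow> int) \<Rightarrow> (nat \<Rightarrow> nat) \<Rightarrow> bool" where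
  "is_m_cover m k a n \<longleftrightarrow>
     (\<forall>x::int. m \<le> card {s \<in> {1..k}. x \<in> residue_class (a s) (n s)})"

definition cover_sum ::
  "nat \<Rightarrow> (nat \<Rightarrow> int) \<Rightarrow> (nat \<Rightarrow> nat) \<Rightarrow> (nat \<Rightarrow> int) \<Rightarrow> (nat \<Rightarrow> complex) \<Rightarrow>
   complex poly \<Rightarrow> real \<Rightarrow> complex"
where
  "cover_sum k a n c \<mu> p \<theta> =
     (\<Sum>I | I \<subseteq> {1..k} \<and> frac (\<Sum>s\<in>I. real_of_int (c s) / real (n s)) = \<theta>.
        (-1) ^ card I * poly p (\<Sum>s\<in>I. \<mu> s) *
        exp (2 * complex_of_real pi * \<i> *
             (\<Sum>s\<in>I. of_int (a s) * of_int (c s) / of_nat (n s))))"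

end

(* Fix an integer x and put w(s) = e((a(s) - x) c(s) / n(s)) with e(t) = exp(2 pi i t). Expanding the
   product over s of 1 - w(s) exp(mu(s) z) and reading off the coefficient of z^j gives, up to the
   factor j!, the sum over theta of e(-x theta) times the cover sum of the monomial X^j at theta.
   By independence of the characters x |-> e(-x theta), these coefficients vanish for every x iff
   all cover sums of X^j vanish. On the other hand, a factor has zero constant term iff w(s) = 1,
   and this zero is simple if mu(s) is nonzero, so the order of the product counts the s with
   w(s) = 1. Since c(s) is prime to n(s), these are the classes that contain x. *)
theory Submission
  imports Defs "HOL-Analysis.Complex_Transcendental"
    "HOL-Computational_Algebra.Formal_Power_Series"
begin

section \<open>Characters of the integers and fractional parts\<close>

lemma exp_2pi_i_eq_iff:
  fixes x y :: real
  shows "exp (2 * complex_of_real pi * \<i> * complex_of_real x) =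
         exp (2 * complex_of_real pi * \<i> * complex_of_real y) \<longleftrightarrow> x - y \<in> \<int>"
proof -
  have "2 * complex_of_real pi * \<i> * complex_of_real x =
        2 * complex_of_real pi * \<i> * complex_of_real y + of_int (2 * N) * pi * \<i> \<longleftrightarrow>
        x - y = of_int N" for N :: int
  proof -
    have "2 * complex_of_real pi * \<i> * complex_of_real x =
        2 * complex_of_real pi * \<i> * complex_of_real y + of_int (2 * N) * pi * \<i> \<longleftrightarrow>
        2 * complex_of_real pi * \<i> * complex_of_real x =
        2 * complex_of_real pi * \<i> * (complex_of_real y + of_int N)"
      by (simp add: algebra_simps)
    also have "\<dots> \<longleftrightarrow> complex_of_real x = complex_of_real (y + of_int N)"
      by simp
    also have "\<dots> \<longleftrightarrow> x - y = of_int N"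
      by (subst of_real_eq_iff) auto
    finally show ?thesis .
  qed
  then show ?thesis
    unfolding exp_eq Ints_def by auto
qed

lemma frac_eq_iff_diff_Ints:
  fixes x \<theta> :: real
  assumes "0 \<le> \<theta>" "\<theta> < 1"
  shows "frac x = \<theta> \<longleftrightarrow> x - \<theta> \<in> \<int>"
  using assms frac_unique_iff[of x \<theta>] by auto

text \<open>A Vandermonde argument without determinants: by linearity the powers may be replaced by
  any polynomial in \<open>z I\<close>, and a polynomial vanishing at every value of
  \<open>z\<close> other than \<open>y\<close> isolates the fibre over \<open>y\<close>.\<close>

lemma power_sums_zero_imp_fibre_sums_zero:
  fixes g z :: "'i \<Rightarrow> 'a :: idom"
  assumes fin: "finite S"
    and zero: "\<And>N :: nat. (\<Sum>I\<in>S. g I * z I ^ N) = 0"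
  shows "(\<Sum>I | I \<in> S \<and> z I = y. g I) = 0"
proof -
  have poly_zero: "(\<Sum>I\<in>S. g I * poly q (z I)) = 0" for q
  proof -
    have "(\<Sum>I\<in>S. g I * poly q (z I)) =
          (\<Sum>I\<in>S. \<Sum>i\<le>degree q. coeff q i * (g I * z I ^ i))"
      by (simp add: poly_altdef sum_distrib_left mult_ac)
    also have "\<dots> = (\<Sum>i\<le>degree q. coeff q i * (\<Sum>I\<in>S. g I * z I ^ i))"
      by (subst sum.swap) (simp add: sum_distrib_left)
    finally show ?thesis by (simp add: zero)
  qed
  \<comment> \<open>This is the Lagrange basis polynomial at \<open>y\<close> up to normalisation.
    Its value at \<open>y\<close> is a product of nonzero differences, so it can be cancelled in an
    integral domain.\<close>
  define q where "q = (\<Prod>v\<in>z ` S - {y}. [:- v, 1:])"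
  have q_eq: "poly q v = (\<Prod>u\<in>z ` S - {y}. v - u)" for v
    by (simp add: q_def poly_prod)
  have "0 = (\<Sum>I\<in>S. g I * poly q (z I))"
    by (simp add: poly_zero)
  also have "\<dots> = (\<Sum>I | I \<in> S \<and> z I = y. g I * poly q (z I))"
    using fin by (intro sum.mono_neutral_right) (auto simp: q_eq)
  also have "\<dots> = (\<Sum>I | I \<in> S \<and> z I = y. g I) * poly q y"
    by (simp add: sum_distrib_right)
  finally show ?thesis
    using fin by (auto simp: q_eq)
qed

text \<open>From left to right, the values x = 0, 1, 2, ... already suffice: they give the power
  sums of the numbers e(-r I), and two of these numbers agree iff the frequencies agree modulo 1.
  From right to left, the sum is grouped by the fractional part of the frequency.\<close>

lemma character_sums_zero_iff:
  fixes g :: "'i \<Rightarrow> complex" and r :: "'i \<Rightarrow> real"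
  assumes fin: "finite S"
  shows "(\<forall>x::int. (\<Sum>I\<in>S. g I * exp (2 * complex_of_real pi * \<i> * complex_of_real (- of_int x * r I))) = 0)
     \<longleftrightarrow> (\<forall>\<theta>::real. 0 \<le> \<theta> \<and> \<theta> < 1 \<longrightarrow> (\<Sum>I | I \<in> S \<and> frac (r I) = \<theta>. g I) = 0)"
    (is "?L \<longleftrightarrow> ?R")
proof
  assume L: ?L
  show ?R
  proof (intro allI impI)
    fix \<theta> :: real
    assume \<theta>: "0 \<le> \<theta> \<and> \<theta> < 1"
    define z where "z t = exp (2 * complex_of_real pi * \<i> * complex_of_real (- t))" for t
    have z_power: "z t ^ N = exp (2 * complex_of_real pi * \<i> * complex_of_real (- of_int (int N) * t))"
      for t N
      by (simp add: z_def flip: exp_of_nat_mult) (simp add: mult_ac)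
    have "(\<Sum>I | I \<in> S \<and> z (r I) = z \<theta>. g I) = 0"
      using L by (intro power_sums_zero_imp_fibre_sums_zero[OF fin]) (simp only: z_power)
    moreover have "z t = z \<theta> \<longleftrightarrow> frac t = \<theta>" for t
    proof -
      have "z t = z \<theta> \<longleftrightarrow> - (t - \<theta>) \<in> \<int>"
        unfolding z_def exp_2pi_i_eq_iff by simp
      then show ?thesis
        using \<theta> by (simp add: frac_eq_iff_diff_Ints minus_in_Ints_iff del: minus_diff_eq)
    qed
    ultimately show "(\<Sum>I | I \<in> S \<and> frac (r I) = \<theta>. g I) = 0"
      by simp
  qed
next
  assume R: ?R
  show ?L
  proof
    fix x :: int
    define E where "E t = exp (2 * complex_of_real pi * \<i> * complex_of_real (- of_int x * t))" for t
    \<comment> \<open>Since x is an integer, removing the integer part of t changes the exponent by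
      an integer multiple of 2 pi i.\<close>
    have E_frac: "E t = E (frac t)" for t
    proof -
      have "- of_int x * t - (- of_int x * frac t) = of_int (- x * \<lfloor>t\<rfloor>)"
        by (simp add: frac_def algebra_simps)
      then show ?thesis
        unfolding E_def exp_2pi_i_eq_iff by (metis Ints_of_int)
    qed
    have "(\<Sum>I\<in>S. g I * E (r I)) =
          (\<Sum>\<theta>\<in>(\<lambda>I. frac (r I)) ` S. \<Sum>I | I \<in> S \<and> frac (r I) = \<theta>. g I * E (r I))"
      by (rule sum.image_gen[OF fin])
    also have "\<dots> = (\<Sum>\<theta>\<in>(\<lambda>I. frac (r I)) ` S. (\<Sum>I | I \<in> S \<and> frac (r I) = \<theta>. g I) * E \<theta>)"
      unfolding sum_distrib_right
      by (intro sum.cong refl) (metis (mono_tags, lifting) E_frac mem_Collect_eq)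
    also have "\<dots> = 0"
      using R by (intro sum.neutral) (auto simp: frac_lt_1)
    finally show "(\<Sum>I\<in>S. g I * exp (2 * complex_of_real pi * \<i> * complex_of_real (- of_int x * r I))) = 0"
      by (simp add: E_def)
  qed
qed

section \<open>The product of the factors 1 - w(s) exp(mu(s) z) as a formal power series\<close>

lemma fps_exp_sum:
  "fps_exp (\<Sum>s\<in>I. \<mu> s) = (\<Prod>s\<in>I. fps_exp (\<mu> s :: 'a :: field_char_0))"
  by (induction I rule: infinite_finite_induct) (auto simp: fps_exp_add_mult)

lemma fps_const_prod: "(\<Prod>s\<in>I. fps_const (w s)) = fps_const (\<Prod>s\<in>I. w s :: 'a :: comm_ring_1)"
  by (induction I rule: infinite_finite_induct) auto

text \<open>In the expansion, \<open>I\<close> records the factors that contribute their exponential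
  term. These exponentials multiply to a single one, whose coefficient at \<open>j\<close> carries
  the denominator j! that \<open>fact j\<close> clears.\<close>

lemma prod_one_minus_exp_nth:
  fixes w \<mu> :: "'i \<Rightarrow> 'a :: field_char_0"
  assumes "finite A"
  shows "fact j * fps_nth (\<Prod>s\<in>A. 1 - fps_const (w s) * fps_exp (\<mu> s)) j =
         (\<Sum>I\<in>Pow A. (- 1) ^ card I * (\<Sum>s\<in>I. \<mu> s) ^ j * (\<Prod>s\<in>I. w s))"
proof -
  have "(\<Prod>s\<in>A. 1 - fps_const (w s) * fps_exp (\<mu> s)) =
        (\<Prod>s\<in>A. fps_const (- w s) * fps_exp (\<mu> s) + 1)"
    by (intro prod.cong refl) (simp flip: fps_const_neg)
  also have "\<dots> = (\<Sum>I\<in>Pow A. \<Prod>s\<in>I. fps_const (- w s) * fps_exp (\<mu> s))"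
    by (subst prod_add[OF assms]) simp
  also have "\<dots> = (\<Sum>I\<in>Pow A. fps_const (\<Prod>s\<in>I. - w s) * fps_exp (\<Sum>s\<in>I. \<mu> s))"
    by (simp only: prod.distrib fps_const_prod fps_exp_sum)
  finally show ?thesis
    by (simp add: fps_sum_nth sum_distrib_left prod_uminus mult_ac)
qed

text \<open>Each factor with \<open>w s = 1\<close> has zero constant term, so it contributes a
  factor \<open>fps_X\<close>. The claim is about coefficients and not about
  \<open>subdegree\<close>, because a vanishing \<open>\<mu> s\<close> can make the whole product
  zero.\<close>

lemma prod_one_minus_exp_nth_eq_0:
  fixes w \<mu> :: "'i \<Rightarrow> 'a :: field_char_0"
  assumes fin: "finite A" and "j < card {s \<in> A. w s = 1}"
  shows "fps_nth (\<Prod>s\<in>A. 1 - fps_const (w s) * fps_exp (\<mu> s)) j = 0"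
proof -
  let ?f = "\<lambda>s. 1 - fps_const (w s) * fps_exp (\<mu> s)"
  have dvd: "fps_X dvd ?f s" if "w s = 1" for s
    using that by (intro dvdI[of _ _ "fps_shift 1 (?f s)"])
      (auto simp: fps_eq_iff)
  have "fps_X ^ card {s \<in> A. w s = 1} = (\<Prod>s | s \<in> A \<and> w s = 1. fps_X :: 'a fps)"
    by simp
  also have "\<dots> dvd prod ?f A"
    using fin dvd by (intro prod_dvd_prod_subset2) auto
  finally obtain g where "prod ?f A = fps_X ^ card {s \<in> A. w s = 1} * g"
    by (rule dvdE)
  then show ?thesis
    using assms(2) by (simp add: fps_X_power_mult_nth)
qed

lemma subdegree_prod_one_minus_exp:
  fixes w \<mu> :: "'i \<Rightarrow> 'a :: field_char_0"
  assumes fin: "finite A" and "\<forall>s\<in>A. \<mu> s \<noteq> 0"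
  defines "F \<equiv> (\<Prod>s\<in>A. 1 - fps_const (w s) * fps_exp (\<mu> s))"
  shows "F \<noteq> 0" and "subdegree F = card {s \<in> A. w s = 1}"
proof -
  let ?f = "\<lambda>s. 1 - fps_const (w s) * fps_exp (\<mu> s)"
  have *: "?f s \<noteq> 0 \<and> subdegree (?f s) = (if w s = 1 then 1 else 0)" if "s \<in> A" for s
  proof (cases "w s = 1")
    case True
    \<comment> \<open>This coefficient is \<open>- \<mu> s\<close>, so the zero of the factor is
      simple.\<close>
    have "fps_nth (?f s) 1 \<noteq> 0"
      using True that assms(2) by simp
    moreover have "fps_nth (?f s) 0 = 0"
      using True by simp
    ultimately have "subdegree (?f s) = 1"
      by (intro subdegreeI) auto
    then show ?thesis using True by auto
  next
    case False
    then have "fps_nth (?f s) 0 \<noteq> 0"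
      by simp
    then show ?thesis
      using False by (metis fps_zero_nth subdegree_eq_0)
  qed
  then show "F \<noteq> 0"
    using fin by (auto simp: F_def)
  have "subdegree F = (\<Sum>s\<in>A. if w s = 1 then 1 else 0)"
    unfolding F_def using * by (subst subdegree_prod) auto
  then show "subdegree F = card {s \<in> A. w s = 1}"
    using fin by (simp add: sum.If_cases Int_def)
qed

section \<open>Reduction from the given polynomials to monomials\<close>

lemma linear_zero_if_zero_on_degrees:
  fixes L :: "'a :: field poly \<Rightarrow> 'a"
  assumes diff: "\<And>p q. L (p - q) = L p - L q" and smult: "\<And>b p. L (smult b p) = b * L p"
    and P: "\<forall>j<m. P j \<noteq> 0 \<and> degree (P j) = j"
    and zero: "\<forall>j<m. L (P j) = 0"
  shows "degree p < m \<Longrightarrow> L p = 0"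
proof (induction "degree p" arbitrary: p rule: less_induct)
  case less
  let ?Q = "P (degree p)"
  \<comment> \<open>With this choice, subtracting \<open>smult b ?Q\<close> cancels the leading term
    of \<open>p\<close>. It does not change \<open>L p\<close>, because \<open>L\<close> vanishes at
    \<open>?Q\<close>, so induction on the degree applies.\<close>
  define b where "b = lead_coeff p / lead_coeff ?Q"
  have Q: "?Q \<noteq> 0" "degree ?Q = degree p" "L ?Q = 0"
    using P zero less.prems by auto
  have L_eq: "L p = L (p - smult b ?Q)"
    by (simp add: diff smult Q)
  show ?case
  proof (cases "degree p = 0")
    case True
    then obtain u v where "p = [:u:]" "?Q = [:v:]"
      using Q(2) by (metis degree_eq_zeroE)
    then have "p - smult b ?Q = 0"
      using Q(1) by (simp add: b_def)
    then show ?thesis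
      using L_eq smult[of 0 0] by simp
  next
    case False
    have "coeff ?Q (degree p) \<noteq> 0"
      using Q by (metis leading_coeff_0_iff)
    then have "coeff (p - smult b ?Q) (degree p) = 0"
      using Q(2) by (simp add: b_def)
    moreover have "degree (p - smult b ?Q) \<le> degree p"
      using Q by (intro degree_diff_le) auto
    ultimately have "degree (p - smult b ?Q) < degree p"
      using False by (metis degree_0 leading_coeff_0_iff le_neq_implies_less neq0_conv)
    then show ?thesis
      using less L_eq by simp
  qed
qed

lemma cover_sum_diff: "cover_sum k a n c \<mu> (p - q) \<theta> = cover_sum k a n c \<mu> p \<theta> - cover_sum k a n c \<mu> q \<theta>"
  by (simp add: cover_sum_def left_diff_distrib right_diff_distrib sum_subtractf)

lemma cover_sum_smult: "cover_sum k a n c \<mu> (smult b p) \<theta> = b * cover_sum k a n c \<mu> p \<theta>"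
  by (simp add: cover_sum_def sum_distrib_left mult_ac)

text \<open>Both families have one member of each degree below \<open>m\<close>, so the vanishing of
  a linear functional on either one passes to all polynomials of degree below \<open>m\<close>,
  hence to the other family.\<close>

lemma cover_sums_zero_iff_monom:
  assumes "\<forall>j<m. P j \<noteq> 0 \<and> degree (P j) = j"
  shows "(\<forall>j<m. cover_sum k a n c \<mu> (P j) \<theta> = 0) \<longleftrightarrow>
         (\<forall>j<m. cover_sum k a n c \<mu> (monom 1 j) \<theta> = 0)"
proof -
  have zero: "cover_sum k a n c \<mu> p \<theta> = 0"
    if "\<forall>j<m. Q j \<noteq> 0 \<and> degree (Q j) = j" "\<forall>j<m. cover_sum k a n c \<mu> (Q j) \<theta> = 0" "degree p < m"
    for Q p
    using that by (rule linear_zero_if_zero_on_degrees[OF cover_sum_diff cover_sum_smult])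
  have "\<forall>j<m. (monom 1 j :: complex poly) \<noteq> 0 \<and> degree (monom 1 j :: complex poly) = j"
    by (simp add: degree_monom_eq)
  with assms show ?thesis
    using zero by metis
qed

section \<open>Cover sums of monomials as coefficients of the product\<close>

definition shifted_root :: "(nat \<Rightarrow> int) \<Rightarrow> (nat \<Rightarrow> nat) \<Rightarrow> (nat \<Rightarrow> int) \<Rightarrow> int \<Rightarrow> nat \<Rightarrow> complex" where
  "shifted_root a n c x s =
     exp (2 * complex_of_real pi * \<i> * complex_of_real (of_int ((a s - x) * c s) / of_nat (n s)))"

text \<open>Up to j!, the coefficient is a character sum in \<open>x\<close> over the subsets
  \<open>I\<close>, with amplitude \<open>g I\<close> and frequency \<open>r I\<close>. The
  amplitudes with \<open>frac (r I) = \<theta>\<close> add up to the cover sum at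
  \<open>\<theta>\<close>, so independence of characters applies.\<close>

lemma cover_sum_monom_zero_iff:
  "(\<forall>\<theta>::real. 0 \<le> \<theta> \<and> \<theta> < 1 \<longrightarrow> cover_sum k a n c \<mu> (monom 1 j) \<theta> = 0) \<longleftrightarrow>
   (\<forall>x. fps_nth (\<Prod>s\<in>{1..k}. 1 - fps_const (shifted_root a n c x s) * fps_exp (\<mu> s)) j = 0)"
proof -
  define r where "r I = (\<Sum>s\<in>I. real_of_int (c s) / real (n s))" for I
  define g where "g I = (- 1) ^ card I * (\<Sum>s\<in>I. \<mu> s) ^ j *
      exp (2 * complex_of_real pi * \<i> * (\<Sum>s\<in>I. of_int (a s) * of_int (c s) / of_nat (n s)))" for I
  \<comment> \<open>The dependence on \<open>x\<close> splits off as the character e(-x r(I)); what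
    remains is the exponential in the cover sum.\<close>
  have root_prod: "(\<Prod>s\<in>I. shifted_root a n c x s) =
      exp (2 * complex_of_real pi * \<i> * (\<Sum>s\<in>I. of_int (a s) * of_int (c s) / of_nat (n s))) *
      exp (2 * complex_of_real pi * \<i> * complex_of_real (- of_int x * r I))" if "finite I" for x I
  proof -
    have "(\<Sum>s\<in>I. complex_of_real (of_int ((a s - x) * c s) / of_nat (n s))) =
        (\<Sum>s\<in>I. of_int (a s) * of_int (c s) / of_nat (n s) +
          complex_of_real (- of_int x) * (of_int (c s) / of_nat (n s)))"
      by (intro sum.cong refl) (simp add: left_diff_distrib diff_divide_distrib)
    also have "\<dots> = (\<Sum>s\<in>I. of_int (a s) * of_int (c s) / of_nat (n s)) +
        complex_of_real (- of_int x * r I)"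
      by (simp only: sum.distrib r_def of_real_mult of_real_sum sum_distrib_left
          of_real_divide of_real_of_int_eq of_real_of_nat_eq)
    finally have exponent: "(\<Sum>s\<in>I. complex_of_real (of_int ((a s - x) * c s) / of_nat (n s))) =
        (\<Sum>s\<in>I. of_int (a s) * of_int (c s) / of_nat (n s)) + complex_of_real (- of_int x * r I)" .
    have "(\<Prod>s\<in>I. shifted_root a n c x s) =
        exp (2 * complex_of_real pi * \<i> *
          (\<Sum>s\<in>I. complex_of_real (of_int ((a s - x) * c s) / of_nat (n s))))"
      using that by (simp only: exp_sum shifted_root_def sum_distrib_left)
    then show ?thesis
      by (simp only: exponent distrib_left exp_add)
  qed
  have coeff_eq: "fact j * fps_nth (\<Prod>s\<in>{1..k}. 1 - fps_const (shifted_root a n c x s) * fps_exp (\<mu> s)) j =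
      (\<Sum>I\<in>Pow {1..k}. g I * exp (2 * complex_of_real pi * \<i> * complex_of_real (- of_int x * r I)))" for x
  proof -
    have "finite I" if "I \<in> Pow {1..k}" for I
      using that finite_subset by auto
    then show ?thesis
      unfolding prod_one_minus_exp_nth[OF finite_atLeastAtMost]
      by (intro sum.cong refl) (simp only: g_def root_prod mult.assoc)
  qed
  have "fps_nth (\<Prod>s\<in>{1..k}. 1 - fps_const (shifted_root a n c x s) * fps_exp (\<mu> s)) j = 0 \<longleftrightarrow>
      (\<Sum>I\<in>Pow {1..k}. g I * exp (2 * complex_of_real pi * \<i> * complex_of_real (- of_int x * r I))) = 0" for x
    by (simp only: coeff_eq[symmetric] mult_eq_0_iff fact_nonzero simp_thms)
  moreover have "cover_sum k a n c \<mu> (monom 1 j) \<theta> =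
      (\<Sum>I | I \<in> Pow {1..k} \<and> frac (r I) = \<theta>. g I)" for \<theta>
    by (simp add: cover_sum_def g_def r_def poly_monom)
  moreover have "finite (Pow {1..k})"
    by simp
  ultimately show ?thesis
    by (simp only: character_sums_zero_iff)
qed

section \<open>Membership in a residue class and roots equal to 1\<close>

lemma mem_residue_class_iff: "x \<in> residue_class b N \<longleftrightarrow> int N dvd b - x"
proof -
  have "x \<in> residue_class b N \<longleftrightarrow> int N dvd x - b"
    by (auto simp: residue_class_def dvd_def algebra_simps)
  then show ?thesis by (simp add: dvd_diff_commute)
qed

lemma shifted_root_eq_1_iff:
  assumes "n s > 0"
  shows "shifted_root a n c x s = 1 \<longleftrightarrow> int (n s) dvd (a s - x) * c s"
proof -
  have "shifted_root a n c x s = 1 \<longleftrightarrow>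
        of_int ((a s - x) * c s) / real (n s) \<in> \<int>"
    using exp_2pi_i_eq_iff[of "of_int ((a s - x) * c s) / real (n s)" 0]
    by (simp only: shifted_root_def of_real_0 mult_zero_right exp_zero diff_0_right)
  also have "\<dots> \<longleftrightarrow> int (n s) dvd (a s - x) * c s"
    using assms of_int_div_of_int_in_Ints_iff[of "(a s - x) * c s" "int (n s)", where 'a = real]
    by simp
  finally show ?thesis .
qed

theorem theorem4p1:
  fixes m k :: nat
    and P :: "nat \<Rightarrow> complex poly"
    and a c :: "nat \<Rightarrow> int"
    and n :: "nat \<Rightarrow> nat"
    and \<mu> :: "nat \<Rightarrow> complex"
  assumes "m > 0"
    and "\<forall>j\<in>{0..m-1}. P j \<noteq> 0 \<and> degree (P j) = j"
    and "\<forall>s\<in>{1..k}. n s > 0"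
  shows "(is_m_cover m k a n \<longrightarrow>
            (\<forall>\<theta>::real. 0 \<le> \<theta> \<and> \<theta> < 1 \<longrightarrow>
              (\<forall>j\<in>{0..m-1}. cover_sum k a n c \<mu> (P j) \<theta> = 0)))
       \<and> ((\<forall>s\<in>{1..k}. coprime (c s) (int (n s))) \<and> (\<forall>s\<in>{1..k}. \<mu> s \<noteq> 0) \<and>
            (\<forall>\<theta>::real. 0 \<le> \<theta> \<and> \<theta> < 1 \<longrightarrow>
              (\<forall>j\<in>{0..m-1}. cover_sum k a n c \<mu> (P j) \<theta> = 0))
          \<longrightarrow> is_m_cover m k a n)"
proof -
  \<comment> \<open>Subtraction is truncated, so this rests on \<open>m > 0\<close>: for
    \<open>m = 0\<close> the left side would be {0}.\<close>
  have range: "{0..m-1} = {..<m}"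
    using assms(1) by auto
  have P: "\<forall>j<m. P j \<noteq> 0 \<and> degree (P j) = j"
    using assms(2) by (simp add: range)
  define F where "F x = (\<Prod>s\<in>{1..k}. 1 - fps_const (shifted_root a n c x s) * fps_exp (\<mu> s))" for x
  have "(\<forall>\<theta>::real. 0 \<le> \<theta> \<and> \<theta> < 1 \<longrightarrow> (\<forall>j\<in>{0..m-1}. cover_sum k a n c \<mu> (P j) \<theta> = 0)) \<longleftrightarrow>
        (\<forall>j<m. \<forall>\<theta>::real. 0 \<le> \<theta> \<and> \<theta> < 1 \<longrightarrow> cover_sum k a n c \<mu> (monom 1 j) \<theta> = 0)"
    using cover_sums_zero_iff_monom[OF P] unfolding range by blast
  then have sums_iff: "(\<forall>\<theta>::real. 0 \<le> \<theta> \<and> \<theta> < 1 \<longrightarrow> (\<forall>j\<in>{0..m-1}. cover_sum k a n c \<mu> (P j) \<theta> = 0)) \<longleftrightarrow>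
        (\<forall>j<m. \<forall>x. fps_nth (F x) j = 0)"
    unfolding cover_sum_monom_zero_iff F_def .
  have "\<forall>j<m. \<forall>x. fps_nth (F x) j = 0" if cover: "is_m_cover m k a n"
  proof (intro allI impI)
    fix j x assume "j < m"
    also have "m \<le> card {s \<in> {1..k}. x \<in> residue_class (a s) (n s)}"
      using cover by (simp add: is_m_cover_def)
    \<comment> \<open>If \<open>n s\<close> divides \<open>a s - x\<close>, it divides the multiple
      by \<open>c s\<close>. Without coprimality only this inclusion is available, and it is enough
      here.\<close>
    also have "\<dots> \<le> card {s \<in> {1..k}. shifted_root a n c x s = 1}"
      using assms(3) by (intro card_mono) (auto simp: mem_residue_class_iff shifted_root_eq_1_iff)
    finally show "fps_nth (F x) j = 0"
      unfolding F_def by (intro prod_one_minus_exp_nth_eq_0) auto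
  qed
  moreover have "is_m_cover m k a n"
    if coprime: "\<forall>s\<in>{1..k}. coprime (c s) (int (n s))" and \<mu>: "\<forall>s\<in>{1..k}. \<mu> s \<noteq> 0"
      and zero: "\<forall>j<m. \<forall>x. fps_nth (F x) j = 0"
    unfolding is_m_cover_def
  proof
    fix x
    have "F x \<noteq> 0"
      unfolding F_def using \<mu> by (intro subdegree_prod_one_minus_exp(1)) auto
    then have "m \<le> subdegree (F x)"
      using zero by (intro subdegree_geI) auto
    also have "\<dots> = card {s \<in> {1..k}. shifted_root a n c x s = 1}"
      unfolding F_def using \<mu> by (intro subdegree_prod_one_minus_exp(2)) auto
    \<comment> \<open>Coprimality allows \<open>c s\<close> to be cancelled from the divisibility,
      which turns the inclusion into an equality.\<close>
    also have "{s \<in> {1..k}. shifted_root a n c x s = 1} = {s \<in> {1..k}. x \<in> residue_class (a s) (n s)}"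
      using assms(3) coprime
      by (auto simp: mem_residue_class_iff shifted_root_eq_1_iff coprime_commute coprime_dvd_mult_left_iff)
    finally show "m \<le> card {s \<in> {1..k}. x \<in> residue_class (a s) (n s)}" .
  qed
  ultimately show ?thesis
    unfolding sums_iff by blast
qed

end
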